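(* Let $f:\mathbb{R}^d\times\mathbb{R}^n\to\mathbb{R}$ be smooth (twice continuously differentiable), possibly nonconvex in $x$ and $\mu$-strongly concave in $y$, and let $\Phi(x)=\max_{y\in\mathbb{R}^n}f(x,y)$, $y^*(x)=\operatorname{argmax}_yf(x,y)$. Suppose $\Phi$ has a strict local minimum. Then a strict local minimax point of the problem $\min_x\max_yf(x,y)$ exists, and strict local minimax points are equivalent to strict local minima of $\Phi$: a pair $(x,y)$ is a strict local minimax point of $f$ if and only if $x$ is a strict local minimum of $\Phi$ and $y=y^*(x)$.
   Context: A point $(x,y)$ is a strict local minimax point of a twice differentiable $f$ if $\nabla f(x,y)=0$, $\nabla^2_{yy}f(x,y)\prec0$ and $\nabla^2_{xx}f(x,y)-\nabla^2_{xy}f(x,y)\,\nabla^2_{yy}f(x,y)^{-1}\,\nabla^2_{yx}f(x,y)\succ0$. A strict local minimum of $\Phi$ is understood in the second-order sense: a point $x$ with $\nabla\Phi(x)=0$ and $\nabla^2\Phi(x)\succ0$. *)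

theory Defs
  imports "HOL-Analysis.Analysis"
begin

definition twice_continuously_differentiable ::
    "('a::real_normed_vector \<Rightarrow> real) \<Rightarrow> bool" where
  "twice_continuously_differentiable g \<longleftrightarrow>
     (\<exists>(g' :: 'a \<Rightarrow> 'a \<Rightarrow>\<^sub>L real) (g'' :: 'a \<Rightarrow> 'a \<Rightarrow>\<^sub>L ('a \<Rightarrow>\<^sub>L real)).
        (\<forall>z. (g has_derivative blinfun_apply (g' z)) (at z)) \<and>
        (\<forall>z. (g' has_derivative blinfun_apply (g'' z)) (at z)) \<and>
        continuous_on UNIV g'')"

definition twice_differentiable_at ::
    "('a::real_normed_vector \<Rightarrow> real) \<Rightarrow> 'a \<Rightarrow> bool" where
  "twice_differentiable_at g x \<longleftrightarrow>
     (\<exists>g' :: 'a \<Rightarrow> 'a \<Rightarrow>\<^sub>L real.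
        (\<forall>\<^sub>F z in nhds x. (g has_derivative blinfun_apply (g' z)) (at z)) \<and>
        g' differentiable (at x))"

definition strongly_concave :: "real \<Rightarrow> ('a::real_normed_vector \<Rightarrow> real) \<Rightarrow> bool" where
  "strongly_concave \<mu> g \<longleftrightarrow> \<mu> > 0 \<and>
     (\<forall>u v t. 0 \<le> t \<and> t \<le> 1 \<longrightarrow>
        t * g u + (1 - t) * g v + \<mu> / 2 * t * (1 - t) * (norm (u - v))\<^sup>2
          \<le> g (t *\<^sub>R u + (1 - t) *\<^sub>R v))"

definition grad :: "(real ^ 'k::finite \<Rightarrow> real) \<Rightarrow> real ^ 'k \<Rightarrow> real ^ 'k" where
  "grad g x = (\<chi> i. frechet_derivative g (at x) (axis i 1))"

definition hessian :: "(real ^ 'k::finite \<Rightarrow> real) \<Rightarrow> real ^ 'k \<Rightarrow> real ^ 'k ^ 'k" where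
  "hessian g x = jacobian (grad g) (at x)"

definition pos_definite :: "real ^ 'k::finite ^ 'k \<Rightarrow> bool" where
  "pos_definite A \<longleftrightarrow> transpose A = A \<and> (\<forall>v. v \<noteq> 0 \<longrightarrow> 0 < v \<bullet> (A *v v))"

abbreviation neg_definite :: "real ^ 'k::finite ^ 'k \<Rightarrow> bool" where
  "neg_definite A \<equiv> pos_definite (- A)"

definition grad_x :: "(real ^ 'd::finite \<Rightarrow> real ^ 'n::finite \<Rightarrow> real) \<Rightarrow> real ^ 'd \<Rightarrow> real ^ 'n \<Rightarrow> real ^ 'd" where
  "grad_x f x y = grad (\<lambda>x'. f x' y) x"

definition grad_y :: "(real ^ 'd::finite \<Rightarrow> real ^ 'n::finite \<Rightarrow> real) \<Rightarrow> real ^ 'd \<Rightarrow> real ^ 'n \<Rightarrow> real ^ 'n" where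
  "grad_y f x y = grad (\<lambda>y'. f x y') y"

definition hess_xx :: "(real ^ 'd::finite \<Rightarrow> real ^ 'n::finite \<Rightarrow> real) \<Rightarrow> real ^ 'd \<Rightarrow> real ^ 'n \<Rightarrow> real ^ 'd ^ 'd" where
  "hess_xx f x y = jacobian (\<lambda>x'. grad_x f x' y) (at x)"

definition hess_xy :: "(real ^ 'd::finite \<Rightarrow> real ^ 'n::finite \<Rightarrow> real) \<Rightarrow> real ^ 'd \<Rightarrow> real ^ 'n \<Rightarrow> real ^ 'n ^ 'd"
  \<comment> \<open>rows are indexed by the components of \<open>x\<close>, columns by those of \<open>y\<close>\<close>
  where "hess_xy f x y = jacobian (\<lambda>y'. grad_x f x y') (at y)"

definition hess_yx :: "(real ^ 'd::finite \<Rightarrow> real ^ 'n::finite \<Rightarrow> real) \<Rightarrow> real ^ 'd \<Rightarrow> real ^ 'n \<Rightarrow> real ^ 'd ^ 'n" where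
  "hess_yx f x y = jacobian (\<lambda>x'. grad_y f x' y) (at x)"

definition hess_yy :: "(real ^ 'd::finite \<Rightarrow> real ^ 'n::finite \<Rightarrow> real) \<Rightarrow> real ^ 'd \<Rightarrow> real ^ 'n \<Rightarrow> real ^ 'n ^ 'n" where
  "hess_yy f x y = jacobian (\<lambda>y'. grad_y f x y') (at y)"

text \<open>The conjuncts \<^const>\<open>twice_differentiable_at\<close> below make sure that the gradients and
  Hessians genuinely exist, since \<^const>\<open>frechet_derivative\<close> is total.\<close>

definition strict_local_minimax ::
    "(real ^ 'd::finite \<Rightarrow> real ^ 'n::finite \<Rightarrow> real) \<Rightarrow> real ^ 'd \<Rightarrow> real ^ 'n \<Rightarrow> bool" where
  "strict_local_minimax f x y \<longleftrightarrow>
     twice_differentiable_at (\<lambda>(x, y). f x y) (x, y) \<and>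
     grad_x f x y = 0 \<and> grad_y f x y = 0 \<and>
     neg_definite (hess_yy f x y) \<and>
     pos_definite (hess_xx f x y - hess_xy f x y ** matrix_inv (hess_yy f x y) ** hess_yx f x y)"

definition strict_local_min :: "(real ^ 'd::finite \<Rightarrow> real) \<Rightarrow> real ^ 'd \<Rightarrow> bool"
  \<comment> \<open>strict local minimum in the second-order sense\<close>
  where "strict_local_min \<phi> x \<longleftrightarrow>
     twice_differentiable_at \<phi> x \<and> grad \<phi> x = 0 \<and> pos_definite (hessian \<phi> x)"

definition max_value :: "('a \<Rightarrow> 'b \<Rightarrow> real) \<Rightarrow> 'a \<Rightarrow> real"
  \<comment> \<open>the maximum of \<open>f x\<close> over all \<open>y\<close>; not \<^const>\<open>Max\<close>, which is for finite sets only\<close>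
  where "max_value f x = (GREATEST v. v \<in> range (f x))"

definition y_star :: "('a \<Rightarrow> 'b \<Rightarrow> real) \<Rightarrow> 'a \<Rightarrow> 'b" where
  "y_star f x = (ARG_MAX (f x) y. True)"

end

theory Submission imports Defs begin

text \<open>
  By strong concavity, \<open>y\<^sup>*(x)\<close> is the only zero of the strongly monotone map \<open>\<nabla>\<^sub>y f(x, \<cdot>)\<close>, and
  \<open>\<nabla>\<^sup>2\<^sub>y\<^sub>y f\<close> is negative definite everywhere. Strong monotonicity gives
  \<open>\<mu> |y\<^sup>*(x) - y\<^sup>*(a)| \<le> |\<nabla>\<^sub>y f(x, y\<^sup>*(a))|\<close>, so \<open>y\<^sup>*\<close> is continuous and differentiable with derivative
  \<open>- (\<nabla>\<^sup>2\<^sub>y\<^sub>y f)\<^sup>-\<^sup>1 \<nabla>\<^sup>2\<^sub>y\<^sub>x f\<close>. Hence \<open>\<nabla>\<Phi>(x) = \<nabla>\<^sub>x f(x, y\<^sup>*(x))\<close>, and differentiating once more shows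
  that the Hessian of \<open>\<Phi>\<close> is the Schur complement in the definition of a strict local minimax point.
\<close>

section \<open>Symmetry of the second derivative\<close>

text \<open>The mean value theorem turns the second difference into a difference of
  \<open>f'\<close> at two points near \<open>x\<close>, and the differentiability of
  \<open>f'\<close> at \<open>x\<close> expands that difference to first order.\<close>

lemma has_derivative_second_difference:
  fixes f :: "'a::real_normed_vector \<Rightarrow> real" and f'' :: "'a \<Rightarrow> 'a \<Rightarrow>\<^sub>L real"
  assumes f': "\<And>z. (f has_derivative blinfun_apply (f' z)) (at z)"
    and f'': "(f' has_derivative f'') (at x)"
    and "0 < e"
  shows "\<exists>d>0. \<forall>t. 0 < t \<and> t < d \<longrightarrow>
    \<bar>f (x + t *\<^sub>R u + t *\<^sub>R v) - f (x + t *\<^sub>R u) - f (x + t *\<^sub>R v) + f x - t\<^sup>2 * f'' u v\<bar> \<le> e * t\<^sup>2"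
proof -
  \<comment> \<open>The summand 1 keeps \<open>N\<close> positive when \<open>u = v = 0\<close>. All
    points used below lie within \<open>t * N\<close> of \<open>x\<close>.\<close>
  define N where "N = norm u + norm v + 1"
  have N: "N > 0" unfolding N_def by (smt (verit) norm_ge_zero)
  \<comment> \<open>The final error is twice \<open>e' * (t * N)\<close> times \<open>t * N\<close>,
    which this choice makes equal to \<open>e * t\<^sup>2\<close>.\<close>
  define e' where "e' = e / (2 * N * N)"
  have e': "e' > 0" using \<open>0 < e\<close> N by (simp add: e'_def)
  have lin: "linear f''" using f'' by (simp add: has_derivative_linear)
  from f'' e' obtain d where d: "d > 0"
    and bnd: "\<And>y. norm (y - x) < d \<Longrightarrow> norm (f' y - f' x - f'' (y - x)) \<le> e' * norm (y - x)"
    unfolding has_derivative_at_alt by blast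
  show ?thesis
  proof (intro exI[of _ "d / N"] conjI allI impI)
    show "0 < d / N" using d N by simp
    fix t assume t: "0 < t \<and> t < d / N"
    have tN: "t * N < d" using t N by (simp add: pos_less_divide_eq)
    \<comment> \<open>The second difference is \<open>g 1 - g 0\<close>: the increment in direction
      \<open>u\<close> is frozen while the point moves along \<open>v\<close>.\<close>
    define g where "g s = f (x + t *\<^sub>R u + s *\<^sub>R (t *\<^sub>R v)) - f (x + s *\<^sub>R (t *\<^sub>R v))" for s
    define g' where "g' s = (\<lambda>r. f' (x + t *\<^sub>R u + s *\<^sub>R (t *\<^sub>R v)) (r *\<^sub>R (t *\<^sub>R v))
        - f' (x + s *\<^sub>R (t *\<^sub>R v)) (r *\<^sub>R (t *\<^sub>R v)))" for s
    have shift: "((\<lambda>s. f (w + s *\<^sub>R (t *\<^sub>R v))) has_derivative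
        (\<lambda>r. f' (w + s *\<^sub>R (t *\<^sub>R v)) (r *\<^sub>R (t *\<^sub>R v)))) (at s)" for w s
      by (rule has_derivative_compose[OF _ f']) (auto intro!: derivative_eq_intros)
    have "(g has_derivative g' s) (at s)" for s
      unfolding g_def g'_def by (rule has_derivative_diff[OF shift shift])
    then have "\<exists>s\<in>{0<..<1}. g 1 - g 0 = g' s (1 - 0)"
      by (intro mvt_simple) (auto intro: has_derivative_at_withinI)
    then obtain s where s: "0 < s" "s < 1" "g 1 - g 0 = g' s 1" by auto
    have small: "norm (w - x) \<le> t * N"
      if "w = x + t *\<^sub>R u + s *\<^sub>R (t *\<^sub>R v) \<or> w = x + s *\<^sub>R (t *\<^sub>R v)" for w
    proof -
      have "norm (w - x) \<le> norm (t *\<^sub>R u) + norm (s *\<^sub>R (t *\<^sub>R v))"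
        using that norm_triangle_ineq[of "t *\<^sub>R u" "s *\<^sub>R (t *\<^sub>R v)"]
        by (auto simp: add.assoc)
      also have "\<dots> = t * norm u + s * (t * norm v)" using t s by simp
      also have "\<dots> \<le> t * norm u + 1 * (t * norm v)"
        using t s by (intro add_left_mono mult_right_mono) auto
      also have "\<dots> \<le> t * N" using t by (simp add: N_def algebra_simps)
      finally show ?thesis .
    qed
    define p where "p = x + t *\<^sub>R u + s *\<^sub>R (t *\<^sub>R v)"
    define q where "q = x + s *\<^sub>R (t *\<^sub>R v)"
    define R where "R w = f' w - f' x - f'' (w - x)" for w
    have R: "norm (R w) \<le> e' * (t * N)" if "w = p \<or> w = q" for w
    proof -
      have "norm (w - x) \<le> t * N" using small that by (simp add: p_def q_def)
      then show ?thesis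
        using bnd[of w] tN e' unfolding R_def
        by (meson le_less_trans less_imp_le mult_left_mono order.trans)
    qed
    have "f' p - f' q = f'' (p - x) - f'' (q - x) + (R p - R q)"
      by (simp add: R_def)
    also have "f'' (p - x) - f'' (q - x) = t *\<^sub>R f'' u"
      by (simp add: p_def q_def linear_add[OF lin] linear_scale[OF lin])
    finally have pq: "f' p - f' q = t *\<^sub>R f'' u + (R p - R q)" .
    have "g 1 - g 0 = (f' p - f' q) (t *\<^sub>R v)"
      using s by (simp add: g'_def p_def q_def blinfun.diff_left)
    also have "\<dots> = t\<^sup>2 * f'' u v + (R p - R q) (t *\<^sub>R v)"
      unfolding pq by (simp add: blinfun.add_left blinfun.scaleR_left blinfun.scaleR_right power2_eq_square distrib_left)
    finally have "\<bar>g 1 - g 0 - t\<^sup>2 * f'' u v\<bar> \<le> norm (R p - R q) * norm (t *\<^sub>R v)"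
      using norm_blinfun[of "R p - R q" "t *\<^sub>R v"] by simp
    also have "\<dots> \<le> (e' * (t * N) + e' * (t * N)) * (t * N)"
    proof (rule mult_mono)
      show "norm (R p - R q) \<le> e' * (t * N) + e' * (t * N)"
        using R[OF disjI1[OF refl]] R[OF disjI2[OF refl]] norm_triangle_ineq4[of "R p" "R q"] by linarith
      show "norm (t *\<^sub>R v) \<le> t * N" using t by (simp add: N_def)
    qed (use e' N t in auto)
    also have "\<dots> = e * t\<^sup>2" using N by (simp add: e'_def field_simps power2_eq_square)
    finally show "\<bar>f (x + t *\<^sub>R u + t *\<^sub>R v) - f (x + t *\<^sub>R u) - f (x + t *\<^sub>R v) + f x - t\<^sup>2 * f'' u v\<bar> \<le> e * t\<^sup>2"
      by (simp add: g_def algebra_simps)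
  qed
qed

text \<open>The second difference is symmetric in \<open>u\<close> and \<open>v\<close>, so both
  values approximate the same quantity divided by \<open>t\<^sup>2\<close>.\<close>

lemma symmetric_second_derivative:
  fixes f :: "'a::real_normed_vector \<Rightarrow> real" and f'' :: "'a \<Rightarrow> 'a \<Rightarrow>\<^sub>L real"
  assumes f': "\<And>z. (f has_derivative blinfun_apply (f' z)) (at z)"
    and f'': "(f' has_derivative f'') (at x)"
  shows "f'' u v = f'' v u"
proof -
  have "\<bar>f'' u v - f'' v u\<bar> \<le> 0 + e" if "0 < e" for e
  proof -
    have "0 < e / 2" using that by simp
    note D = has_derivative_second_difference[OF f' f'' this]
    obtain d1 where d1: "d1 > 0" "\<And>t. 0 < t \<and> t < d1 \<Longrightarrow>
      \<bar>f (x + t *\<^sub>R u + t *\<^sub>R v) - f (x + t *\<^sub>R u) - f (x + t *\<^sub>R v) + f x - t\<^sup>2 * f'' u v\<bar> \<le> e / 2 * t\<^sup>2"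
      using D[of u v] by blast
    obtain d2 where d2: "d2 > 0" "\<And>t. 0 < t \<and> t < d2 \<Longrightarrow>
      \<bar>f (x + t *\<^sub>R v + t *\<^sub>R u) - f (x + t *\<^sub>R v) - f (x + t *\<^sub>R u) + f x - t\<^sup>2 * f'' v u\<bar> \<le> e / 2 * t\<^sup>2"
      using D[of v u] by blast
    obtain t where t: "0 < t" "t < d1" "t < d2"
      using d1(1) d2(1) by (metis field_lbound_gt_zero)
    have swap: "x + t *\<^sub>R v + t *\<^sub>R u = x + t *\<^sub>R u + t *\<^sub>R v" by simp
    have "\<bar>t\<^sup>2 * f'' u v - t\<^sup>2 * f'' v u\<bar> \<le> e * t\<^sup>2"
      using d1(2)[of t] d2(2)[of t] t unfolding swap abs_le_iff by auto
    moreover have "\<bar>t\<^sup>2 * f'' u v - t\<^sup>2 * f'' v u\<bar> = t\<^sup>2 * \<bar>f'' u v - f'' v u\<bar>"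
      by (simp add: right_diff_distrib[symmetric] abs_mult)
    ultimately have "t\<^sup>2 * \<bar>f'' u v - f'' v u\<bar> \<le> t\<^sup>2 * e" by (simp add: mult.commute)
    then show ?thesis using t by simp
  qed
  then have "\<bar>f'' u v - f'' v u\<bar> \<le> 0" by (rule field_le_epsilon)
  then show ?thesis by simp
qed

section \<open>Differentiability of an implicitly defined function\<close>

text \<open>A Lipschitz bound on the solution replaces the completeness and the continuous
  differentiability that the implicit function theorem needs to construct it.\<close>

lemma has_derivative_implicit:
  fixes G :: "'a::real_normed_vector \<times> 'b::real_normed_vector \<Rightarrow> 'c::real_normed_vector"
  assumes G: "(G has_derivative G') (at (a, Y a))"
    and zero: "\<And>x. G (x, Y x) = 0"
    and lip: "\<And>x. norm (Y x - Y a) \<le> K * norm (G (x, Y a))"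
    and B: "bounded_linear B" "\<And>k. B (G' (0, k)) = k"
  shows "(Y has_derivative (\<lambda>h. - B (G' (h, 0)))) (at a)"
proof -
  interpret G': bounded_linear G' using G by (rule has_derivative_bounded_linear)
  interpret B: bounded_linear B by fact
  obtain C where C: "C > 0" "\<And>z. norm (G' z) \<le> norm z * C" using G'.pos_bounded by blast
  obtain M where M: "M > 0" "\<And>z. norm (B z) \<le> norm z * M" using B.pos_bounded by blast
  note alt = G[unfolded has_derivative_at_alt, THEN conjunct2, rule_format]
  \<comment> \<open>Accuracy 1 is enough here: it only serves to bound \<open>G (x, Y a)\<close> by
    \<open>C + 1\<close> times the distance of \<open>x\<close> from \<open>a\<close>.\<close>
  obtain d0 where d0: "d0 > 0" "\<And>z. norm (z - (a, Y a)) < d0 \<Longrightarrow>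
      norm (G z - G (a, Y a) - G' (z - (a, Y a))) \<le> 1 * norm (z - (a, Y a))"
    using alt[of 1] by auto
  define L where "L = \<bar>K\<bar> * (C + 1)"
  have L: "L \<ge> 0" using C by (simp add: L_def)
  have Y: "norm (Y x - Y a) \<le> L * norm (x - a)" if x: "norm (x - a) < d0" for x
  proof -
    have e: "(x, Y a) - (a, Y a) = (x - a, 0)" by simp
    have "norm (G (x, Y a) - G' (x - a, 0)) \<le> norm (x - a)"
      using d0(2)[of "(x, Y a)"] x unfolding e by (simp add: zero)
    moreover have "norm (G' (x - a, 0)) \<le> norm (x - a) * C" using C(2)[of "(x - a, 0)"] by simp
    ultimately have "norm (G (x, Y a)) \<le> (C + 1) * norm (x - a)"
      using norm_triangle_ineq2[of "G (x, Y a)" "G' (x - a, 0)"] by (simp add: algebra_simps)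
    then have "\<bar>K\<bar> * norm (G (x, Y a)) \<le> \<bar>K\<bar> * ((C + 1) * norm (x - a))"
      by (intro mult_left_mono) auto
    moreover have "norm (Y x - Y a) \<le> \<bar>K\<bar> * norm (G (x, Y a))"
      by (rule order.trans[OF lip]) (intro mult_right_mono, auto)
    ultimately show ?thesis by (simp add: L_def mult.assoc)
  qed
  show ?thesis
    unfolding has_derivative_at_alt
  proof (intro conjI allI impI)
    show "bounded_linear (\<lambda>h. - B (G' (h, 0)))"
      by (intro bounded_linear_minus B.bounded_linear bounded_linear_compose[OF B(1)]
          bounded_linear_compose[OF G'.bounded_linear] bounded_linear_Pair bounded_linear_ident bounded_linear_zero)
    fix e :: real assume e: "0 < e"
    define e' where "e' = e / (M * (1 + L))"
    have e': "e' > 0" using e M L by (simp add: e'_def)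
    then obtain d where d: "d > 0" "\<And>z. norm (z - (a, Y a)) < d \<Longrightarrow>
        norm (G z - G (a, Y a) - G' (z - (a, Y a))) \<le> e' * norm (z - (a, Y a))"
      using alt[of e'] by auto
    show "\<exists>d>0. \<forall>y. norm (y - a) < d \<longrightarrow> norm (Y y - Y a - - B (G' (y - a, 0))) \<le> e * norm (y - a)"
    \<comment> \<open>The bound \<open>d0\<close> makes the Lipschitz estimate for \<open>Y\<close>
      available; \<open>d / (1 + L)\<close> then puts \<open>(x, Y x)\<close> within
      \<open>d\<close> of \<open>(a, Y a)\<close>.\<close>
    proof (intro exI[of _ "min d0 (d / (1 + L))"] conjI allI impI)
      show "0 < min d0 (d / (1 + L))" using d0 d L by simp
      fix x assume x: "norm (x - a) < min d0 (d / (1 + L))"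
      define w where "w = (x - a, Y x - Y a)"
      have w: "(x, Y x) - (a, Y a) = w" by (simp add: w_def)
      have nw: "norm w \<le> (1 + L) * norm (x - a)"
        using norm_Pair_le[of "x - a" "Y x - Y a"] Y[of x] x by (simp add: w_def algebra_simps)
      also have "\<dots> < d" using x L by (simp add: pos_less_divide_eq mult.commute)
      \<comment> \<open>\<open>G\<close> vanishes at both points, so the remainder of the linear
        approximation is just \<open>- G' w\<close>.\<close>
      finally have "norm (G' w) \<le> e' * norm w"
        using d(2)[of "(x, Y x)"] unfolding w by (simp add: zero)
      also have "\<dots> \<le> e' * ((1 + L) * norm (x - a))"
        using e' nw by (intro mult_left_mono) auto
      finally have "norm (G' w) * M \<le> e' * ((1 + L) * norm (x - a)) * M"
        using M(1) by simp
      also have "\<dots> = e * norm (x - a)" using M L unfolding e'_def by (simp add: divide_simps)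
      finally have "norm (B (G' w)) \<le> e * norm (x - a)" using M(2)[of "G' w"] by simp
      \<comment> \<open>\<open>B\<close> undoes the partial derivative in the second argument, so it
        maps \<open>G' w\<close> to the linearization error of \<open>Y\<close>.\<close>
      moreover have "B (G' w) = Y x - Y a - - B (G' (x - a, 0))"
      proof -
        have "G' w = G' (x - a, 0) + G' (0, Y x - Y a)" by (simp add: w_def G'.add[symmetric])
        then show ?thesis by (simp add: B.add B(2))
      qed
      ultimately show "norm (Y x - Y a - - B (G' (x - a, 0))) \<le> e * norm (x - a)" by simp
    qed
  qed
qed

section \<open>Strongly concave functions\<close>

text \<open>Strong concavity on the segment from \<open>u\<close> to \<open>v\<close>, divided by
  \<open>t\<close>, bounds the difference quotient at \<open>u\<close> from below; then
  \<open>t\<close> tends to 0 from the right.\<close>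

lemma strongly_concave_upper_bound:
  fixes g :: "'a::real_normed_vector \<Rightarrow> real"
  assumes conc: "strongly_concave \<mu> g" and g': "(g has_derivative g') (at u)"
  shows "g v \<le> g u + g' (v - u) - \<mu> / 2 * (norm (v - u))\<^sup>2"
proof -
  define w where "w = v - u"
  have "((\<lambda>t. g (u + t *\<^sub>R w)) has_derivative (\<lambda>t. g' (t *\<^sub>R w))) (at 0)"
    by (rule has_derivative_compose[where g = g and g' = g']) (auto intro!: derivative_eq_intros simp: g')
  moreover have "g' (t *\<^sub>R w) = t * g' w" for t
    using linear_scale[OF has_derivative_linear[OF g']] by simp
  ultimately have "((\<lambda>t. g (u + t *\<^sub>R w)) has_field_derivative g' w) (at 0)"
    by (simp add: has_field_derivative_def mult.commute[of _ "g' w"] mult_commute_abs)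
  then have lim: "((\<lambda>t. (g (u + t *\<^sub>R w) - g u) / t) \<longlongrightarrow> g' w) (at_right 0)"
    by (auto simp: has_field_derivative_iff intro: filterlim_mono[OF _ order_refl at_le])
  have lim2: "((\<lambda>t. g v - g u + \<mu> / 2 * (1 - t) * (norm w)\<^sup>2) \<longlongrightarrow>
      g v - g u + \<mu> / 2 * (1 - 0) * (norm w)\<^sup>2) (at_right 0)"
    by (intro tendsto_intros)
  have "\<forall>\<^sub>F t in at_right 0. g v - g u + \<mu> / 2 * (1 - t) * (norm w)\<^sup>2 \<le> (g (u + t *\<^sub>R w) - g u) / t"
    unfolding eventually_at_right_field
  proof (intro exI[of _ 1] conjI allI impI)
    fix t :: real assume t: "0 < t" "t < 1"
    then have "t * g v + (1 - t) * g u + \<mu> / 2 * t * (1 - t) * (norm (v - u))\<^sup>2 \<le> g (t *\<^sub>R v + (1 - t) *\<^sub>R u)"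
      using conc unfolding strongly_concave_def by (meson less_imp_le)
    also have "t *\<^sub>R v + (1 - t) *\<^sub>R u = u + t *\<^sub>R w" by (simp add: w_def algebra_simps)
    finally have "(g v - g u + \<mu> / 2 * (1 - t) * (norm w)\<^sup>2) * t \<le> g (u + t *\<^sub>R w) - g u"
      by (simp add: w_def algebra_simps)
    then show "g v - g u + \<mu> / 2 * (1 - t) * (norm w)\<^sup>2 \<le> (g (u + t *\<^sub>R w) - g u) / t"
      using t by (simp add: pos_le_divide_eq)
  qed simp
  from tendsto_le[OF _ lim lim2 this] show ?thesis by (simp add: w_def)
qed

text \<open>Adding the upper bounds based at \<open>u\<close> and at \<open>v\<close> cancels the
  function values.\<close>

lemma strongly_concave_strongly_monotone:
  fixes g :: "'a::real_normed_vector \<Rightarrow> real"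
  assumes "strongly_concave \<mu> g"
    and "(g has_derivative g'u) (at u)" and "(g has_derivative g'v) (at v)"
  shows "g'v (v - u) - g'u (v - u) \<le> - \<mu> * (norm (v - u))\<^sup>2"
proof -
  have "g'v (u - v) = - g'v (v - u)"
    using linear_neg[OF has_derivative_linear[OF assms(3)], of "v - u"] by simp
  then show ?thesis
    using strongly_concave_upper_bound[OF assms(1,2), of v]
      strongly_concave_upper_bound[OF assms(1,3), of u]
    by (simp add: norm_minus_commute)
qed

text \<open>The upper bound at 0 confines the search to a compact ball, where continuity gives a
  maximum.\<close>

lemma strongly_concave_attains_max:
  fixes g :: "'a::euclidean_space \<Rightarrow> real"
  assumes conc: "strongly_concave \<mu> g" and diff: "\<And>u. g differentiable (at u)"
  obtains u where "\<And>v. g v \<le> g u"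
proof -
  have \<mu>: "\<mu> > 0" using conc by (simp add: strongly_concave_def)
  obtain g' where g': "(g has_derivative g') (at 0)" using diff by (auto simp: differentiable_def)
  obtain C where C: "C > 0" "\<And>z. norm (g' z) \<le> norm z * C"
    using bounded_linear.pos_bounded[OF has_derivative_bounded_linear[OF g']] by blast
  define r where "r = 2 * C / \<mu>" \<comment> \<open>outside this radius the quadratic term dominates: \<open>g v \<le> g 0\<close>\<close>
  have r: "r > 0" using C \<mu> by (simp add: r_def)
  have "continuous_on (cball 0 r) g"
    using diff by (meson continuous_at_imp_continuous_on differentiable_imp_continuous_within)
  then obtain u where u: "u \<in> cball 0 r" "\<And>v. v \<in> cball 0 r \<Longrightarrow> g v \<le> g u"
    using continuous_attains_sup[of "cball 0 r" g] r by auto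
  have "g v \<le> g u" for v
  proof (cases "v \<in> cball 0 r")
    case False
    then have "C \<le> \<mu> / 2 * norm v" using \<mu> by (simp add: r_def field_simps)
    then have "norm v * C \<le> norm v * (\<mu> / 2 * norm v)" by (rule mult_left_mono) simp
    then have "g' v \<le> \<mu> / 2 * (norm v)\<^sup>2"
      using C(2)[of v] unfolding power2_eq_square real_norm_def by argo
    then have "g v \<le> g 0" using strongly_concave_upper_bound[OF conc g', of v] by simp
    also have "\<dots> \<le> g u" using u(2)[of 0] r by simp
    finally show ?thesis .
  qed (use u in simp)
  then show ?thesis by (rule that)
qed

section \<open>Gradients, Jacobians and symmetric matrices\<close>

lemma linear_vec_lambda_inner:
  fixes A :: "real ^ 'k::finite \<Rightarrow> real"
  assumes "linear A"
  shows "(\<chi> i. A (axis i 1)) \<bullet> h = A h"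
proof -
  have "(\<chi> i. A (axis i 1)) \<bullet> h = A (\<Sum>i\<in>UNIV. h $ i *\<^sub>R axis i 1)"
    by (simp add: inner_vec_def linear_sum[OF assms] linear_scale[OF assms] mult.commute)
  also have "(\<Sum>i\<in>UNIV. h $ i *\<^sub>R axis i 1) = h"
    using basis_expansion[of h] by (simp add: scalar_mult_eq_scaleR)
  finally show ?thesis .
qed

lemma grad_inner:
  assumes "(g has_derivative g') (at x)"
  shows "grad g x \<bullet> h = g' h"
  using linear_vec_lambda_inner[OF has_derivative_linear[OF assms]]
  by (simp add: grad_def frechet_derivative_at[OF assms, symmetric])

lemma grad_eqI:
  assumes "(g has_derivative (\<lambda>h. w \<bullet> h)) (at x)"
  shows "grad g x = w"
  using grad_inner[OF assms] by (metis vector_eq_rdot)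

lemma jacobian_mult_vec:
  fixes g :: "real ^ 'k::finite \<Rightarrow> real ^ 'm::finite"
  assumes "(g has_derivative g') (at x)"
  shows "jacobian g (at x) *v h = g' h"
  using assms by (simp add: jacobian_def frechet_derivative_at[OF assms, symmetric] has_derivative_linear)

lemma has_derivative_vec_lambda:
  fixes g :: "'k::finite \<Rightarrow> 'a::real_normed_vector \<Rightarrow> real"
  assumes "\<And>i. (g i has_derivative g' i) (at x)"
  shows "((\<lambda>z. \<chi> i. g i z) has_derivative (\<lambda>h. \<chi> i. g' i h)) (at x)"
  unfolding has_derivative_componentwise_within[of "\<lambda>z. \<chi> i. g i z"]
  using assms by (auto simp: Basis_vec_def inner_axis)

text \<open>In this form matrix symmetry follows directly from the symmetry of a second derivative
  as a bilinear form.\<close>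

lemma transpose_eq_iff_inner:
  fixes A :: "real ^ 'k::finite ^ 'k"
  shows "transpose A = A \<longleftrightarrow> (\<forall>v w. v \<bullet> (A *v w) = w \<bullet> (A *v v))"
proof -
  have "transpose A = A \<longleftrightarrow> (\<forall>w. transpose A *v w = A *v w)" by (rule matrix_eq)
  also have "\<dots> \<longleftrightarrow> (\<forall>w v. v \<bullet> (transpose A *v w) = v \<bullet> (A *v w))"
    by (metis vector_eq_ldot)
  also have "\<dots> \<longleftrightarrow> (\<forall>v w. v \<bullet> (A *v w) = w \<bullet> (A *v v))"
    by (auto simp: dot_lmul_matrix[symmetric] inner_commute)
  finally show ?thesis .
qed

section \<open>Partial gradients and Hessian blocks\<close>

text \<open>The derivatives are parameters, so that the existential witnesses in
  \<open>twice_continuously_differentiable\<close> are chosen once for all lemmas.\<close>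

locale smooth_strongly_concave =
  fixes f :: "real ^ 'd::finite \<Rightarrow> real ^ 'n::finite \<Rightarrow> real"
    and F' :: "(real ^ 'd) \<times> (real ^ 'n) \<Rightarrow> ((real ^ 'd) \<times> (real ^ 'n)) \<Rightarrow>\<^sub>L real"
    and F'' :: "(real ^ 'd) \<times> (real ^ 'n) \<Rightarrow>
      ((real ^ 'd) \<times> (real ^ 'n)) \<Rightarrow>\<^sub>L (((real ^ 'd) \<times> (real ^ 'n)) \<Rightarrow>\<^sub>L real)"
    and \<mu> :: real
  assumes F': "\<And>z. ((\<lambda>(x, y). f x y) has_derivative blinfun_apply (F' z)) (at z)"
    and F'': "\<And>z. (F' has_derivative blinfun_apply (F'' z)) (at z)"
    and conc: "\<And>x. strongly_concave \<mu> (f x)"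
begin

lemma mu_pos: "\<mu> > 0"
  using conc by (simp add: strongly_concave_def)

lemma has_derivative_compose_pair:
  assumes "(a has_derivative a') (at t)" "(b has_derivative b') (at t)"
  shows "((\<lambda>s. f (a s) (b s)) has_derivative (\<lambda>h. F' (a t, b t) (a' h, b' h))) (at t)"
  using has_derivative_compose[OF has_derivative_Pair[OF assms] F'] by simp

lemma has_derivative_x: "((\<lambda>x. f x y) has_derivative (\<lambda>h. F' (x, y) (h, 0))) (at x)"
  by (rule has_derivative_compose_pair) (auto intro!: derivative_eq_intros)

lemma has_derivative_y: "(f x has_derivative (\<lambda>h. F' (x, y) (0, h))) (at y)"
  by (rule has_derivative_compose_pair) (auto intro!: derivative_eq_intros)

lemma grad_x_inner: "grad_x f x y \<bullet> h = F' (x, y) (h, 0)"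
  unfolding grad_x_def by (rule grad_inner[OF has_derivative_x])

lemma grad_y_inner: "grad_y f x y \<bullet> h = F' (x, y) (0, h)"
  unfolding grad_y_def by (rule grad_inner[OF has_derivative_y])

text \<open>This is the joint derivative of the partial gradient, combining the blocks
  \<open>hess_xx\<close> and \<open>hess_xy\<close>; the chain rule along
  \<open>(x, y_star f x)\<close> needs both at once.\<close>

definition dgrad_x :: "(real ^ 'd) \<times> (real ^ 'n) \<Rightarrow> (real ^ 'd) \<times> (real ^ 'n) \<Rightarrow> real ^ 'd" where
  "dgrad_x z k = (\<chi> i. F'' z k (axis i 1, 0))"

definition dgrad_y :: "(real ^ 'd) \<times> (real ^ 'n) \<Rightarrow> (real ^ 'd) \<times> (real ^ 'n) \<Rightarrow> real ^ 'n" where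
  "dgrad_y z k = (\<chi> i. F'' z k (0, axis i 1))"

lemma has_derivative_F'_apply: "((\<lambda>z. F' z w) has_derivative (\<lambda>k. F'' z k w)) (at z)"
  by (rule bounded_linear.has_derivative[OF blinfun.bounded_linear_left F''])

lemma has_derivative_grad_x: "((\<lambda>z. grad_x f (fst z) (snd z)) has_derivative dgrad_x z) (at z)"
proof -
  have "grad_x f (fst z) (snd z) $ i = F' z (axis i 1, 0)" for z i
    by (simp add: cart_eq_inner_axis grad_x_inner)
  then have "grad_x f (fst z) (snd z) = (\<chi> i. F' z (axis i 1, 0))" for z
    by (simp add: vec_eq_iff)
  then show ?thesis
    by (simp add: dgrad_x_def[abs_def] has_derivative_vec_lambda has_derivative_F'_apply)
qed

lemma has_derivative_grad_y: "((\<lambda>z. grad_y f (fst z) (snd z)) has_derivative dgrad_y z) (at z)"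
proof -
  have "grad_y f (fst z) (snd z) $ i = F' z (0, axis i 1)" for z i
    by (simp add: cart_eq_inner_axis grad_y_inner)
  then have "grad_y f (fst z) (snd z) = (\<chi> i. F' z (0, axis i 1))" for z
    by (simp add: vec_eq_iff)
  then show ?thesis
    by (simp add: dgrad_y_def[abs_def] has_derivative_vec_lambda has_derivative_F'_apply)
qed

lemmas linear_dgrad_x = has_derivative_linear[OF has_derivative_grad_x]

lemma dgrad_y_inner: "dgrad_y z k \<bullet> w = F'' z k (0, w)"
proof -
  have "bounded_linear (\<lambda>w. F'' z k (0, w))"
    by (intro bounded_linear_intros)
  then show ?thesis
    unfolding dgrad_y_def by (intro linear_vec_lambda_inner bounded_linear.linear)
qed

lemma has_derivative_grad_x_pair:
  assumes "(a has_derivative a') (at t)" "(b has_derivative b') (at t)"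
  shows "((\<lambda>s. grad_x f (a s) (b s)) has_derivative (\<lambda>h. dgrad_x (a t, b t) (a' h, b' h))) (at t)"
  using has_derivative_compose[OF has_derivative_Pair[OF assms] has_derivative_grad_x] by simp

lemma has_derivative_grad_y_pair:
  assumes "(a has_derivative a') (at t)" "(b has_derivative b') (at t)"
  shows "((\<lambda>s. grad_y f (a s) (b s)) has_derivative (\<lambda>h. dgrad_y (a t, b t) (a' h, b' h))) (at t)"
  using has_derivative_compose[OF has_derivative_Pair[OF assms] has_derivative_grad_y] by simp

lemma hess_xx_mult: "hess_xx f x y *v h = dgrad_x (x, y) (h, 0)"
  unfolding hess_xx_def by (intro jacobian_mult_vec has_derivative_grad_x_pair has_derivative_ident has_derivative_const)

lemma hess_xy_mult: "hess_xy f x y *v k = dgrad_x (x, y) (0, k)"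
  unfolding hess_xy_def by (intro jacobian_mult_vec has_derivative_grad_x_pair has_derivative_ident has_derivative_const)

lemma hess_yx_mult: "hess_yx f x y *v h = dgrad_y (x, y) (h, 0)"
  unfolding hess_yx_def by (intro jacobian_mult_vec has_derivative_grad_y_pair has_derivative_ident has_derivative_const)

lemma hess_yy_mult: "hess_yy f x y *v k = dgrad_y (x, y) (0, k)"
  unfolding hess_yy_def by (intro jacobian_mult_vec has_derivative_grad_y_pair has_derivative_ident has_derivative_const)

section \<open>Negative definiteness in \<open>y\<close>\<close>

lemma grad_y_monotone:
  "(grad_y f x v - grad_y f x u) \<bullet> (v - u) \<le> - \<mu> * (norm (v - u))\<^sup>2"
  using strongly_concave_strongly_monotone[OF conc has_derivative_y has_derivative_y]
  by (simp add: inner_diff_left grad_y_inner)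

text \<open>This is the infinitesimal form of \<open>grad_y_monotone\<close>: the points
  \<open>y\<close> and \<open>y + t *\<^sub>R v\<close> are compared and \<open>t\<close> tends to 0
  from the right.\<close>

lemma hess_yy_bound: "v \<bullet> (hess_yy f x y *v v) \<le> - \<mu> * (norm v)\<^sup>2"
proof -
  define p where "p t = grad_y f x (y + t *\<^sub>R v) \<bullet> v" for t
  have "((\<lambda>t. grad_y f x (y + t *\<^sub>R v)) has_derivative (\<lambda>t. dgrad_y (x, y + 0 *\<^sub>R v) (0, t *\<^sub>R v))) (at 0)"
    by (rule has_derivative_grad_y_pair) (auto intro!: derivative_eq_intros)
  then have "((\<lambda>t. grad_y f x (y + t *\<^sub>R v)) has_derivative (\<lambda>t. t *\<^sub>R (hess_yy f x y *v v))) (at 0)"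
    by (simp flip: hess_yy_mult add: matrix_vector_mult_scaleR)
  then have "(p has_derivative (\<lambda>t. t *\<^sub>R (hess_yy f x y *v v) \<bullet> v)) (at 0)"
    unfolding p_def by (rule has_derivative_inner_left)
  then have "(p has_field_derivative (hess_yy f x y *v v) \<bullet> v) (at 0)"
    by (simp add: has_field_derivative_def mult.commute[of _ "(hess_yy f x y *v v) \<bullet> v"] mult_commute_abs)
  then have lim: "((\<lambda>t. (p t - p 0) / t) \<longlongrightarrow> (hess_yy f x y *v v) \<bullet> v) (at_right 0)"
    by (auto simp: has_field_derivative_iff intro: filterlim_mono[OF _ order_refl at_le])
  have "\<forall>\<^sub>F t in at_right 0. (p t - p 0) / t \<le> - \<mu> * (norm v)\<^sup>2"
    unfolding eventually_at_right_field
  proof (intro exI[of _ 1] conjI allI impI)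
    fix t :: real assume t: "0 < t" "t < 1"
    \<comment> \<open>The displacement \<open>t *\<^sub>R v\<close> enters the inner product once
      and the squared norm twice, so one factor \<open>t\<close> cancels here and one in the
      quotient.\<close>
    have "t * (p t - p 0) \<le> t * (- \<mu> * (norm v)\<^sup>2 * t)"
      using grad_y_monotone[of x "y + t *\<^sub>R v" y]
      by (simp add: p_def inner_diff_left power2_eq_square algebra_simps)
    then have "p t - p 0 \<le> - \<mu> * (norm v)\<^sup>2 * t"
      using t by (simp only: mult_le_cancel_left_pos)
    then show "(p t - p 0) / t \<le> - \<mu> * (norm v)\<^sup>2"
      using t by (simp add: pos_divide_le_eq)
  qed simp
  then have "(hess_yy f x y *v v) \<bullet> v \<le> - \<mu> * (norm v)\<^sup>2"
    by (intro tendsto_upperbound[OF lim]) auto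
  then show ?thesis by (simp add: inner_commute)
qed

lemma hess_yy_symmetric: "v \<bullet> (hess_yy f x y *v w) = w \<bullet> (hess_yy f x y *v v)"
  using symmetric_second_derivative[OF F' F'', of "(x, y)" "(0, w)" "(0, v)"]
  by (simp add: hess_yy_mult dgrad_y_inner inner_commute[of _ "dgrad_y _ _"])

lemma neg_definite_hess_yy: "neg_definite (hess_yy f x y)"
  unfolding pos_definite_def transpose_eq_iff_inner
proof (intro conjI allI impI)
  have minus: "- A *v v = - (A *v v)" for A :: "real ^ 'n ^ 'n" and v
    by (simp add: vec_eq_iff matrix_vector_mult_def sum_negf)
  show "v \<bullet> (- hess_yy f x y *v w) = w \<bullet> (- hess_yy f x y *v v)" for v w
    using hess_yy_symmetric[of v x y w] by (simp add: minus)
  fix v :: "real ^ 'n" assume "v \<noteq> 0"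
  then have "0 < \<mu> * (norm v)\<^sup>2" using mu_pos by simp
  then show "0 < v \<bullet> (- hess_yy f x y *v v)"
    using hess_yy_bound[of v x y] by (simp add: minus)
qed

text \<open>The bound forces a trivial kernel, so the choice made by \<open>matrix_inv\<close> is a
  genuine inverse.\<close>

lemma matrix_inv_hess_yy: "matrix_inv (hess_yy f x y) *v (hess_yy f x y *v v) = v"
proof -
  have "v = 0" if "hess_yy f x y *v v = 0" for v
    using hess_yy_bound[of v x y] that mu_pos by (auto simp: mult_le_0_iff)
  then have "invertible (hess_yy f x y)"
    by (auto simp: invertible_left_inverse matrix_left_invertible_ker)
  then have "matrix_inv (hess_yy f x y) ** hess_yy f x y = mat 1"
    unfolding invertible_def matrix_inv_def by (rule someI2_ex) simp
  then show ?thesis by (simp add: matrix_vector_mul_assoc)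
qed

section \<open>The maximizer and the value function\<close>

lemma y_star_maximal: "f x y \<le> f x (y_star f x)"
proof -
  have "f x differentiable (at u)" for u
    using has_derivative_y by (rule differentiableI)
  then obtain u where "\<And>v. f x v \<le> f x u"
    using strongly_concave_attains_max[OF conc] by blast
  then show ?thesis
    unfolding y_star_def using arg_max_equality[of "\<lambda>_. True" u "f x"] by simp
qed

lemma grad_y_y_star: "grad_y f x (y_star f x) = 0"
proof -
  have "(\<lambda>h. F' (x, y_star f x) (0, h)) = (\<lambda>h. 0)"
    by (rule differential_zero_maxmin[OF _ open_UNIV has_derivative_y]) (auto simp: y_star_maximal)
  then show ?thesis by (metis grad_y_inner inner_eq_zero_iff)
qed

text \<open>Strong monotonicity forces two zeros of the partial gradient to coincide.\<close>

lemma y_star_unique: "grad_y f x y = 0 \<longleftrightarrow> y = y_star f x"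
proof
  assume "grad_y f x y = 0"
  then have "0 \<le> - \<mu> * (norm (y - y_star f x))\<^sup>2"
    using grad_y_monotone[of x y "y_star f x"] by (simp add: grad_y_y_star)
  then show "y = y_star f x" using mu_pos by (simp add: mult_le_0_iff)
qed (simp add: grad_y_y_star)

lemma max_value_eq: "max_value f x = f x (y_star f x)"
  unfolding max_value_def using y_star_maximal by (auto intro: Greatest_equality)

text \<open>The stationarity equation is solved by \<open>has_derivative_implicit\<close>, with
  Lipschitz constant \<open>1 / \<mu>\<close> from strong monotonicity and Cauchy-Schwarz.\<close>

lemma has_derivative_y_star:
  "(y_star f has_derivative
    (\<lambda>h. - (matrix_inv (hess_yy f x (y_star f x)) *v (hess_yx f x (y_star f x) *v h)))) (at x)"
  unfolding hess_yx_mult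
proof (rule has_derivative_implicit[OF has_derivative_grad_y])
  show "grad_y f (fst (u, y_star f u)) (snd (u, y_star f u)) = 0" for u
    by (simp add: grad_y_y_star)
  fix u
  define d where "d = y_star f u - y_star f x"
  have "\<mu> * (norm d)\<^sup>2 \<le> grad_y f u (y_star f x) \<bullet> d"
    using grad_y_monotone[of u "y_star f u" "y_star f x"] by (simp add: grad_y_y_star d_def)
  also have "\<dots> \<le> norm (grad_y f u (y_star f x)) * norm d"
    by (rule norm_cauchy_schwarz)
  finally have "\<mu> * norm d \<le> norm (grad_y f u (y_star f x))"
    by (cases "d = 0") (auto simp: power2_eq_square)
  then show "norm (y_star f u - y_star f x)
      \<le> 1 / \<mu> * norm (grad_y f (fst (u, y_star f x)) (snd (u, y_star f x)))"
    using mu_pos by (simp add: d_def field_simps)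
next
  show "matrix_inv (hess_yy f x (y_star f x)) *v dgrad_y (x, y_star f x) (0, k) = k" for k
    by (simp add: matrix_inv_hess_yy flip: hess_yy_mult)
qed simp

text \<open>Envelope theorem: the variation of \<open>y_star f\<close> contributes nothing because
  the partial gradient in \<open>y\<close> vanishes there.\<close>

lemma has_derivative_max_value:
  "(max_value f has_derivative (\<lambda>h. grad_x f x (y_star f x) \<bullet> h)) (at x)"
proof -
  have "F' (x, y_star f x) (h, k) = F' (x, y_star f x) (h, 0) + F' (x, y_star f x) (0, k)" for h k
    by (simp flip: blinfun.add_right)
  then have "F' (x, y_star f x) (h, k) = grad_x f x (y_star f x) \<bullet> h" for h k
    by (simp add: grad_y_y_star flip: grad_x_inner grad_y_inner)
  then show ?thesis
    using has_derivative_compose_pair[OF has_derivative_ident has_derivative_y_star, of x]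
    by (simp add: max_value_eq[abs_def])
qed

lemma grad_max_value: "grad (max_value f) x = grad_x f x (y_star f x)"
  by (rule grad_eqI[OF has_derivative_max_value])

lemma has_derivative_grad_max_value:
  "((\<lambda>x. grad_x f x (y_star f x)) has_derivative
    (\<lambda>h. (hess_xx f x (y_star f x) - hess_xy f x (y_star f x) **
      matrix_inv (hess_yy f x (y_star f x)) ** hess_yx f x (y_star f x)) *v h)) (at x)"
proof -
  \<comment> \<open>The second component is negated to match the sign in the derivative of
    \<open>y_star f\<close>; this is where the minus sign of the Schur complement arises.\<close>
  have split: "dgrad_x z (h, - k) = dgrad_x z (h, 0) - dgrad_x z (0, k)" for z h k
    using linear_diff[OF linear_dgrad_x, of z "(h, 0)" "(0, k)"] by simp
  show ?thesis
    using has_derivative_grad_x_pair[OF has_derivative_ident has_derivative_y_star, of x]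
    by (simp add: split matrix_vector_mult_diff_rdistrib
        flip: hess_xx_mult hess_xy_mult matrix_vector_mul_assoc)
qed

lemma hessian_max_value:
  "hessian (max_value f) x = hess_xx f x (y_star f x) - hess_xy f x (y_star f x) **
    matrix_inv (hess_yy f x (y_star f x)) ** hess_yx f x (y_star f x)"
  unfolding hessian_def grad_max_value[abs_def]
  using jacobian_mult_vec[OF has_derivative_grad_max_value] by (simp add: matrix_eq)

text \<open>\<open>blinfun_inner_right\<close> turns the gradient into the required functional;
  being bounded linear, it preserves differentiability.\<close>

lemma twice_differentiable_max_value: "twice_differentiable_at (max_value f) x"
  unfolding twice_differentiable_at_def
proof (intro exI conjI)
  show "\<forall>\<^sub>F z in nhds x. (max_value f has_derivative
      blinfun_inner_right (grad_x f z (y_star f z))) (at z)"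
    using has_derivative_max_value by (simp add: blinfun_inner_right.rep_eq)
  show "(\<lambda>z. blinfun_inner_right (grad_x f z (y_star f z))) differentiable (at x)"
    by (rule differentiableI[OF bounded_linear.has_derivative[OF
          bounded_linear_blinfun_inner_right has_derivative_grad_max_value]])
qed

lemma twice_differentiable_f: "twice_differentiable_at (\<lambda>(x, y). f x y) z"
  unfolding twice_differentiable_at_def
  using F' differentiableI[OF F''] by (intro exI[of _ F']) auto

text \<open>Stationarity in \<open>y\<close> says \<open>y = y_star f x\<close>; at such a pair the
  remaining first- and second-order conditions on \<open>f\<close> become those on
  \<open>max_value f\<close>.\<close>

lemma strict_local_minimax_iff:
  "strict_local_minimax f x y \<longleftrightarrow> strict_local_min (max_value f) x \<and> y = y_star f x"
  by (auto simp: strict_local_minimax_def strict_local_min_def twice_differentiable_f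
      twice_differentiable_max_value y_star_unique neg_definite_hess_yy grad_max_value hessian_max_value)

end

theorem proposition3p4:
  fixes f :: "real ^ 'd::finite \<Rightarrow> real ^ 'n::finite \<Rightarrow> real"
    and \<mu> :: real
    and \<Phi> :: "real ^ 'd \<Rightarrow> real"
  defines "\<Phi> \<equiv> max_value f"
  assumes "twice_continuously_differentiable (\<lambda>(x, y). f x y)"
    and "\<And>x. strongly_concave \<mu> (f x)"
    and "\<exists>x. strict_local_min \<Phi> x"
  shows "(\<exists>x y. strict_local_minimax f x y) \<and>
    (\<forall>x y. strict_local_minimax f x y \<longleftrightarrow> strict_local_min \<Phi> x \<and> y = y_star f x)"
proof -
  obtain F' F'' where "smooth_strongly_concave f F' F'' \<mu>"
    using assms(2,3) unfolding twice_continuously_differentiable_def smooth_strongly_concave_def by blast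
  then interpret smooth_strongly_concave f F' F'' \<mu> .
  \<comment> \<open>Existence follows by pairing the given strict local minimum \<open>x\<close>
    with \<open>y_star f x\<close>.\<close>
  show ?thesis using assms(4) by (auto simp: \<Phi>_def strict_local_minimax_iff)
qed

end
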